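(* Let $n \geq 2$ be an integer and let $G$ be the complete multipartite graph having $n-1$ parts of size $1$ and one part of size $3$. Then $G$ is (isomorphic to) a subgraph of $G(\mathbb{Q}^n,\sqrt{2})$ but is not (isomorphic to) a subgraph of $G(\mathbb{R}^{n-1},1)$.
   Context: For $S \subseteq \mathbb{R}$, a positive integer $n$ and $d>0$, $G(S^n,d)$ denotes the graph with vertex set $S^n$ in which two vertices are adjacent if and only if their Euclidean distance is exactly $d$. Subgraphs need not be induced. By convention $\mathbb{R}^0$ consists of a single point. *)

theory Defs
  imports
    "HOL-Analysis.L2_Norm"
    "HOL-Library.FuncSet"
    "HOL-Library.Multiset"
    "HOL-Library.Disjoint_Sets"
    "Graph_Theory.Graph_Theory"
begin

text \<open>
  As in the Graph_Theory library, undirected graphs are symmetric digraphs. The power \<open>S\<^sup>n\<close> is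
  the set of extensional functions from \<open>{..<n}\<close> to \<open>S\<close>; in particular \<open>S\<^sup>0\<close> is a single point.
\<close>

definition distance_graph :: "real set \<Rightarrow> nat \<Rightarrow> real \<Rightarrow> (nat \<Rightarrow> real) pair_pre_digraph" where
  "distance_graph S n d =
    \<lparr> pverts = {..<n} \<rightarrow>\<^sub>E S,
      parcs = {(x, y). x \<in> {..<n} \<rightarrow>\<^sub>E S \<and> y \<in> {..<n} \<rightarrow>\<^sub>E S \<and>
        L2_set (\<lambda>i. dist (x i) (y i)) {..<n} = d} \<rparr>"

lemma distance_graph_bidirected:
  assumes "d > 0"
  shows "pair_bidirected_digraph (distance_graph S n d)"
proof -
  let ?V = "{..<n} \<rightarrow>\<^sub>E S" and ?D = "\<lambda>x y :: nat \<Rightarrow> real. L2_set (\<lambda>i. dist (x i) (y i)) {..<n}"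
  have V: "pverts (distance_graph S n d) = ?V"
    unfolding distance_graph_def by (rule pair_pre_digraph.simps)
  have A: "e \<in> parcs (distance_graph S n d) \<longleftrightarrow>
      fst e \<in> ?V \<and> snd e \<in> ?V \<and> ?D (fst e) (snd e) = d" for e
    unfolding distance_graph_def pair_pre_digraph.simps mem_Collect_eq case_prod_beta ..
  have comm: "?D x y = ?D y x" for x y
    by (rule L2_set_cong) (rule refl, rule dist_commute)
  have zero: "?D x x = 0" for x
    by (simp only: dist_self L2_set_def power_zero_numeral sum.neutral_const real_sqrt_zero)
  have S: "sym (parcs (distance_graph S n d))"
    unfolding sym_def A fst_conv snd_conv using comm by blast
  show ?thesis
  proof
    show "symmetric (with_proj (distance_graph S n d))"
      using S by (simp only: symmetric_def with_proj_simps)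
  next
    fix e assume e: "e \<in> parcs (distance_graph S n d)"
    then show "fst e \<in> pverts (distance_graph S n d)" "snd e \<in> pverts (distance_graph S n d)"
      unfolding A V by blast+
    show "fst e \<noteq> snd e"
    proof
      assume eq: "fst e = snd e"
      have "?D (fst e) (snd e) = d" using e unfolding A by blast
      with assms show False unfolding eq zero by blast
    qed
  qed
qed

text \<open>
  The multiset \<open>M\<close> lists the sizes of the parts. The locale predicate \<open>graph\<close> includes finiteness,
  so the partition \<open>P\<close> is finite and \<open>mset_set P\<close> contains each part exactly once.
\<close>

definition complete_multipartite_digraph :: "nat multiset \<Rightarrow> ('a, 'b) pre_digraph \<Rightarrow> bool" where
  "complete_multipartite_digraph M G \<longleftrightarrow> graph G \<and>
    (\<exists>P. partition_on (verts G) P \<and> image_mset card (mset_set P) = M \<and>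
      arcs_ends G = {(u, v). u \<in> verts G \<and> v \<in> verts G \<and> \<not> (\<exists>A\<in>P. u \<in> A \<and> v \<in> A)})"

definition isomorphic_to_subgraph :: "('a, 'b) pre_digraph \<Rightarrow> ('c, 'd) pre_digraph \<Rightarrow> bool" where
  "isomorphic_to_subgraph G K \<longleftrightarrow> (\<exists>H. subgraph H K \<and> digraph_iso G H)"

end

theory Submission
  imports Defs
begin

text \<open>
  In \<open>\<rat>\<^sup>n\<close>, place the singleton parts at the unit vectors \<open>e\<^sub>1, \<dots>, e\<^sub>n\<^sub>-\<^sub>1\<close>. The point
  \<open>(a, \<dots>, a, b)\<close> has distance \<open>\<surd>2\<close> from all of them iff \<open>(n - 1) a\<^sup>2 - 2 a + b\<^sup>2 = 1\<close>, which has
  the three rational solutions \<open>(0, 1)\<close>, \<open>(0, -1)\<close> and \<open>(2 / (n - 1), 1)\<close>.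

  Conversely, let the \<open>m + 3\<close> vertices be placed at points \<open>p v\<close> of \<open>\<real>\<^sup>m\<close>, where \<open>m = n - 1\<close>. The
  vectors \<open>(p v, 1, |p v|\<^sup>2)\<close> lie in a space of dimension \<open>m + 2\<close>, hence there are coefficients
  \<open>c v\<close>, not all zero, such that \<open>(\<Sum>v. c v |p v - x|\<^sup>2) = 0\<close> for every \<open>x\<close> and \<open>(\<Sum>v. c v) = 0\<close>.
  Taking \<open>x = p u\<close> for a singleton part \<open>u\<close> gives \<open>c u = 0\<close>. Taking for \<open>x\<close> each of the three points
  of the large part then shows that any two of the three remaining coefficients have opposite signs,
  so all of them vanish.
\<close>

section \<open>Linear dependence and the obstruction in dimension \<open>m\<close>\<close>

text \<open>Gaussian elimination by induction on the number of equations: the last one, unless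
  vacuous, is spent on eliminating a pivot unknown.\<close>

lemma homogeneous_system_nontrivial_solution:
  fixes f :: "'j \<Rightarrow> nat \<Rightarrow> 'k::field"
  assumes "finite J" and "m < card J"
  shows "\<exists>c. (\<exists>j\<in>J. c j \<noteq> 0) \<and> (\<forall>i<m. (\<Sum>j\<in>J. c j * f j i) = 0)"
  using assms
proof (induction m arbitrary: J f)
  case 0
  then obtain j where "j \<in> J"
    by (metis card.empty ex_in_conv less_irrefl)
  then show ?case
    by (intro exI[of _ "\<lambda>_. 1"]) auto
next
  case (Suc m)
  show ?case
  proof (cases "\<forall>j\<in>J. f j m = 0")
    case True
    from Suc.IH[of J f] Suc.prems
    obtain c where "\<exists>j\<in>J. c j \<noteq> 0" and "\<forall>i<m. (\<Sum>j\<in>J. c j * f j i) = 0"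
      by auto
    with True show ?thesis
      by (intro exI[of _ c]) (auto simp: less_Suc_eq)
  next
    case False
    then obtain k where k: "k \<in> J" "f k m \<noteq> 0" by auto
    \<comment> \<open>Subtracting a multiple of the pivot vector \<open>f k\<close> clears
      coordinate \<open>m\<close> of every vector.\<close>
    define g where "g j i = f j i - f j m / f k m * f k i" for j i
    have "m < card (J - {k})"
      using Suc.prems k(1) by simp
    then obtain c where c: "\<exists>j\<in>J-{k}. c j \<noteq> 0"
      and c0: "\<And>i. i < m \<Longrightarrow> (\<Sum>j\<in>J-{k}. c j * g j i) = 0"
      using Suc.IH[of "J - {k}" g] Suc.prems(1) by blast
    \<comment> \<open>The value \<open>- s\<close> at \<open>k\<close> turns the sums for
      \<open>f\<close> over \<open>J\<close> into those for \<open>g\<close> over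
      \<open>J - {k}\<close>; equation \<open>m\<close> then holds because
      \<open>g j m = 0\<close>.\<close>
    define s where "s = (\<Sum>j\<in>J-{k}. c j * f j m) / f k m"
    have split: "(\<Sum>j\<in>J. (c(k := - s)) j * f j i) = (\<Sum>j\<in>J-{k}. c j * f j i) - s * f k i" for i
      using Suc.prems(1) k(1) by (subst sum.remove[of J k]) auto
    have g: "(\<Sum>j\<in>J-{k}. c j * g j i) = (\<Sum>j\<in>J-{k}. c j * f j i) - s * f k i" for i
      by (simp add: g_def s_def right_diff_distrib sum_subtractf sum_distrib_right
          sum_divide_distrib mult.assoc)
    have gm: "g j m = 0" for j
      using k(2) by (simp add: g_def)
    have "(\<Sum>j\<in>J. (c(k := - s)) j * f j i) = 0" if "i < Suc m" for i
    proof (cases "i = m")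
      case True
      then show ?thesis unfolding split g[symmetric] by (simp add: gm)
    next
      case False
      with that c0[of i] show ?thesis unfolding split g[symmetric] by simp
    qed
    moreover have "\<exists>j\<in>J. (c(k := - s)) j \<noteq> 0"
      using c by auto
    ultimately show ?thesis by blast
  qed
qed

text \<open>The squared distance from a fixed point is linear in the lifted vector of the other
  point, so one dependence controls all distances at once. \<open>pos\<close> expresses that the
  points of \<open>W\<close> are distinct.\<close>

lemma no_equidistant_placement:
  fixes p :: "'a \<Rightarrow> nat \<Rightarrow> real"
  assumes fin: "finite U" and cU: "card U = m" and cW: "card W = 3" and disj: "U \<inter> W = {}"
    and dist: "\<And>u v. u \<in> U \<Longrightarrow> v \<in> U \<union> W \<Longrightarrow> u \<noteq> v \<Longrightarrow> (\<Sum>i<m. (p u i - p v i)\<^sup>2) = r"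
    and r: "r \<noteq> 0"
    and pos: "\<And>v w. v \<in> W \<Longrightarrow> w \<in> W \<Longrightarrow> v \<noteq> w \<Longrightarrow> (\<Sum>i<m. (p v i - p w i)\<^sup>2) > 0"
  shows False
proof -
  let ?V = "U \<union> W"
  let ?D = "\<lambda>u v. \<Sum>i<m. (p u i - p v i)\<^sup>2"
  have finW: "finite W" using cW card.infinite by fastforce
  have V: "finite ?V" "Suc (Suc m) < card ?V"
    using fin finW cU cW disj by (simp_all add: card_Un_disjoint)
  define f where "f v i = (if i < m then p v i else if i = m then 1 else (\<Sum>j<m. (p v j)\<^sup>2))" for v i
  obtain c where nz: "\<exists>v\<in>?V. c v \<noteq> 0"
    and c: "\<And>i. i < Suc (Suc m) \<Longrightarrow> (\<Sum>v\<in>?V. c v * f v i) = 0"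
    using homogeneous_system_nontrivial_solution[OF V, of f] by blast
  have c_p: "(\<Sum>v\<in>?V. c v * p v i) = 0" if "i < m" for i
    using c[of i] that by (simp add: f_def)
  have c_1: "(\<Sum>v\<in>?V. c v) = 0"
    using c[of m] by (simp add: f_def)
  have c_2: "(\<Sum>v\<in>?V. c v * (\<Sum>j<m. (p v j)\<^sup>2)) = 0"
    using c[of "Suc m"] by (simp add: f_def)
  have c_D: "(\<Sum>v\<in>?V. c v * ?D x v) = 0" for x
  proof -
    have "c v * ?D x v = c v * (\<Sum>i<m. (p x i)\<^sup>2) - 2 * (\<Sum>i<m. p x i * (c v * p v i))
        + c v * (\<Sum>i<m. (p v i)\<^sup>2)" for v
      by (simp add: power2_diff sum.distrib sum_subtractf sum_distrib_left algebra_simps)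
    then have "(\<Sum>v\<in>?V. c v * ?D x v) = (\<Sum>v\<in>?V. c v) * (\<Sum>i<m. (p x i)\<^sup>2)
        - 2 * (\<Sum>v\<in>?V. \<Sum>i<m. p x i * (c v * p v i)) + (\<Sum>v\<in>?V. c v * (\<Sum>i<m. (p v i)\<^sup>2))"
      by (simp add: sum.distrib sum_subtractf sum_distrib_left[of 2, symmetric]
          sum_distrib_right[symmetric])
    also have "(\<Sum>v\<in>?V. \<Sum>i<m. p x i * (c v * p v i)) = (\<Sum>i<m. p x i * (\<Sum>v\<in>?V. c v * p v i))"
      by (subst sum.swap) (simp only: sum_distrib_left)
    finally show ?thesis by (simp add: c_1 c_2 c_p)
  qed
  \<comment> \<open>In the relation centred at \<open>p u\<close> the term of \<open>u\<close>
    vanishes and all others carry the factor \<open>r\<close>, leaving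
    \<open>- c u * r = 0\<close>.\<close>
  have cU0: "c u = 0" if u: "u \<in> U" for u
  proof -
    have "0 = (\<Sum>v\<in>?V. c v * ?D u v)" by (simp only: c_D)
    also have "\<dots> = (\<Sum>v\<in>?V-{u}. c v * ?D u v)"
      using u V(1) by (subst sum.remove[of ?V u]) auto
    also have "\<dots> = (\<Sum>v\<in>?V-{u}. c v * r)"
      by (rule sum.cong) (use dist u in auto)
    also have "\<dots> = ((\<Sum>v\<in>?V. c v) - c u) * r"
      using u V(1) by (simp add: sum_distrib_right[symmetric] sum_diff1)
    finally show ?thesis using r c_1 by simp
  qed
  obtain a b d where W: "W = {a, b, d}" and ne: "a \<noteq> b" "a \<noteq> d" "b \<noteq> d"
    using cW by (auto simp: card_3_iff)
  have "(\<Sum>v\<in>?V. c v * ?D x v) = (\<Sum>v\<in>W. c v * ?D x v)" for x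
    by (rule sum.mono_neutral_right) (use V(1) cU0 in auto)
  then have cW0: "c a * ?D x a + c b * ?D x b + c d * ?D x d = 0" for x
    using c_D[of x] ne by (simp add: W)
  have sym: "?D x y = ?D y x" for x y by (simp add: power2_commute)
  define P Q R where "P = ?D a b" and "Q = ?D a d" and "R = ?D b d"
  have pos': "P > 0" "Q > 0" "R > 0"
    unfolding P_def Q_def R_def by (rule pos; use ne W in auto)+
  have eqs: "c b * P + c d * Q = 0" "c a * P + c d * R = 0" "c a * Q + c b * R = 0"
    using cW0[of a] cW0[of b] cW0[of d] sym[of b a] sym[of d a] sym[of d b]
    by (simp_all add: P_def Q_def R_def)
  \<comment> \<open>The symmetric system with zero diagonal has determinant
    \<open>2 * P * Q * R\<close>; this combination of its equations isolates \<open>c d\<close> and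
    does the work of the sign argument.\<close>
  have "2 * (c d * Q * R) = (c b * P + c d * Q) * R + (c a * P + c d * R) * Q
      - (c a * Q + c b * R) * P" by (simp add: algebra_simps)
  then have "c d = 0" using pos' eqs by simp
  with eqs pos' have "c a = 0" "c b = 0" by simp_all
  with \<open>c d = 0\<close> cU0 W nz show False by auto
qed

section \<open>Rational points at squared distance 2\<close>

lemma sum_power2_diff_unit_vector:
  fixes x :: "nat \<Rightarrow> real"
  assumes "a < n"
  shows "(\<Sum>i<n. ((if i = a then 1 else 0) - x i)\<^sup>2) = (\<Sum>i<n. (x i)\<^sup>2) - 2 * x a + 1"
proof -
  have "((if i = a then 1 else 0) - x i)\<^sup>2 = (x i)\<^sup>2 + (if i = a then 1 - 2 * x a else 0)" for i
    by (simp add: power2_diff)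
  then show ?thesis using assms by (simp add: sum.distrib)
qed

text \<open>Injectivity is claimed on \<open>W\<close> only: every other pair of distinct vertices
  is separated by its squared distance 2.\<close>

lemma rational_placement:
  assumes "finite U" and "card U = m" and "m \<noteq> 0" and cW: "card W = 3" and disj: "U \<inter> W = {}"
  obtains p :: "'a \<Rightarrow> nat \<Rightarrow> real"
  where "p ` (U \<union> W) \<subseteq> {..<Suc m} \<rightarrow>\<^sub>E \<rat>" and "inj_on p W"
    and "\<And>u v. u \<in> U \<Longrightarrow> v \<in> U \<union> W \<Longrightarrow> u \<noteq> v \<Longrightarrow> (\<Sum>i<Suc m. (p u i - p v i)\<^sup>2) = 2"
proof -
  obtain h where "bij_betw h U {..<m}"
    using ex_bij_betw_finite_nat[OF assms(1)] assms(2) by (auto simp: atLeast0LessThan)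
  then have h: "\<And>u. u \<in> U \<Longrightarrow> h u < m" and hinj: "inj_on h U"
    by (auto simp: bij_betw_def)
  obtain a b d where W: "W = {a, b, d}" and ne: "a \<noteq> b" "a \<noteq> d" "b \<noteq> d"
    using cW by (auto simp: card_3_iff)
  \<comment> \<open>Coordinate \<open>m\<close> is reserved for the large part. With last coordinate
    1 or -1 and all others \<open>t\<close>, the distance condition reads
    \<open>m * t\<^sup>2 = 2 * t\<close>, hence the value \<open>2 / m\<close>.\<close>
  define q :: "'a \<Rightarrow> nat \<Rightarrow> real" where
    "q v i = (if v \<in> U then if i = h v then 1 else 0
       else if v = a then if i = m then 1 else 0
       else if v = b then if i = m then -1 else 0
       else if i = m then 1 else 2 / m)" for v i
  define p where "p v = restrict (q v) {..<Suc m}" for v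
  have aU: "a \<notin> U" "b \<notin> U" "d \<notin> U" using disj W by auto
  have q: "q u = (\<lambda>i. if i = h u then 1 else 0)" if "u \<in> U" for u
    using that by (auto simp: q_def)
  have qrat: "q v i \<in> \<rat>" for v i
    by (simp add: q_def)
  show ?thesis
  proof
    show "p ` (U \<union> W) \<subseteq> {..<Suc m} \<rightarrow>\<^sub>E \<rat>"
      unfolding p_def using qrat by (intro image_subsetI) (simp only: restrict_PiE_iff, blast)
    \<comment> \<open>Coordinate \<open>m\<close> separates \<open>p b\<close> from the other two;
      coordinate 0, which differs from \<open>m\<close>, separates \<open>p a\<close> from
      \<open>p d\<close>.\<close>
    have "p a m = 1" "p b m = -1" "p d m = 1" "p a 0 = 0" "p d 0 \<noteq> 0"
      using \<open>m \<noteq> 0\<close> aU ne by (auto simp: p_def q_def)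
    then have "p a \<noteq> p b" "p a \<noteq> p d" "p b \<noteq> p d" by auto
    then show "inj_on p W" by (auto simp: W inj_on_def)
    fix u v assume u: "u \<in> U" and v: "v \<in> U \<union> W" and "u \<noteq> v"
    have "(\<Sum>i<Suc m. (p u i - p v i)\<^sup>2) = (\<Sum>i<Suc m. (q u i - q v i)\<^sup>2)"
      by (rule sum.cong) (auto simp: p_def)
    also have "\<dots> = (\<Sum>i<Suc m. (q v i)\<^sup>2) - 2 * q v (h u) + 1"
      unfolding q[OF u] by (rule sum_power2_diff_unit_vector) (use h[OF u] in simp)
    \<comment> \<open>It remains that the squared norm of \<open>q v\<close> is
      \<open>1 + 2 * q v (h u)\<close>: both are 1, except for \<open>v = d\<close>, where both are
      \<open>1 + 4 / m\<close>.\<close>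
    also have "\<dots> = 2"
    proof -
      consider "v \<in> U" | "v = a" | "v = b" | "v = d" using v W by auto
      then show ?thesis
      proof cases
        case 1
        then have "h u \<noteq> h v" using hinj u \<open>u \<noteq> v\<close> by (auto dest: inj_onD)
        moreover have "(q v i)\<^sup>2 = (if i = h v then 1 else 0)" for i
          using 1 by (simp add: q_def)
        ultimately show ?thesis using 1 h[OF 1] by (simp add: q_def)
      next
        case 4
        have "(\<Sum>i<m. (q d i)\<^sup>2) = (\<Sum>i<m. (2 / real m)\<^sup>2)"
          by (rule sum.cong) (use aU ne in \<open>auto simp: q_def\<close>)
        then show ?thesis using 4 h[OF u] aU ne \<open>m \<noteq> 0\<close>
          by (simp add: q_def power2_eq_square)
      qed (use h[OF u] aU ne in \<open>auto simp: q_def\<close>)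
    qed
    finally show "(\<Sum>i<Suc m. (p u i - p v i)\<^sup>2) = 2" .
  qed
qed

section \<open>Subgraph embeddings as adjacency-preserving injections\<close>

text \<open>Without parallel arcs an arc is determined by its ends, so an injective vertex map
  induces an injective arc map. Adjacency is preserved in one direction only, as subgraphs need not
  be induced.\<close>

lemma isomorphic_to_subgraph_with_proj_iff:
  assumes "nomulti_digraph G" and K: "pair_wf_digraph K"
  shows "isomorphic_to_subgraph G (with_proj K) \<longleftrightarrow>
    (\<exists>f. inj_on f (verts G) \<and> f ` verts G \<subseteq> pverts K \<and>
      (\<forall>(u, v)\<in>arcs_ends G. (f u, f v) \<in> parcs K))"
proof
  assume "isomorphic_to_subgraph G (with_proj K)"
  then obtain g where sub: "subgraph (app_iso g G) (with_proj K)"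
    and iso: "pre_digraph.digraph_isomorphism G g"
    by (auto simp: isomorphic_to_subgraph_def digraph_iso_def)
  \<comment> \<open>Compatibility with \<open>with_proj K\<close> forces the projections as tail and
    head, so an arc is sent to the pair of images of its ends.\<close>
  have proj: "iso_tail g = fst" "iso_head g = snd"
    using sub by (auto simp: subgraph_def compatible_def)
  have "(iso_verts g (tail G e), iso_verts g (head G e)) \<in> parcs K" if "e \<in> arcs G" for e
  proof -
    have "iso_arcs g e \<in> parcs K" using sub that by (auto simp: subgraph_def)
    moreover have "iso_arcs g e = (iso_verts g (tail G e), iso_verts g (head G e))"
      using iso that by (simp add: pre_digraph.digraph_isomorphism_def proj)
    ultimately show ?thesis by simp
  qed
  then show "\<exists>f. inj_on f (verts G) \<and> f ` verts G \<subseteq> pverts K \<and>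
      (\<forall>(u, v)\<in>arcs_ends G. (f u, f v) \<in> parcs K)"
    using sub iso
    by (intro exI[of _ "iso_verts g"])
      (auto simp: subgraph_def pre_digraph.digraph_isomorphism_def arcs_ends_conv)
next
  interpret nomulti_digraph G by fact
  assume "\<exists>f. inj_on f (verts G) \<and> f ` verts G \<subseteq> pverts K \<and>
      (\<forall>(u, v)\<in>arcs_ends G. (f u, f v) \<in> parcs K)"
  then obtain f where inj: "inj_on f (verts G)" and fV: "f ` verts G \<subseteq> pverts K"
    and fA: "\<And>e. e \<in> arcs G \<Longrightarrow> (f (tail G e), f (head G e)) \<in> parcs K"
    by (auto simp: arcs_ends_conv)
  define g where "g = \<lparr>iso_verts = f, iso_arcs = (\<lambda>e. (f (tail G e), f (head G e))),
    iso_head = snd, iso_tail = fst\<rparr>"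
  have "inj_on (\<lambda>e. (f (tail G e), f (head G e))) (arcs G)"
    by (rule inj_onI, rule no_multi_arcs) (auto simp: arc_to_ends_def dest: inj_onD[OF inj])
  then have iso: "digraph_isomorphism g"
    using inj by (simp add: digraph_isomorphism_def g_def wf_digraph)
  have "wf_digraph (app_iso g G)"
    by (rule wf_digraphI_app_iso) (fact iso)
  moreover have "wf_digraph (with_proj K)"
    using K by (simp add: wf_digraph_wp_iff)
  ultimately have "subgraph (app_iso g G) (with_proj K)"
    using fV fA by (auto simp: subgraph_def compatible_def g_def)
  with iso show "isomorphic_to_subgraph G (with_proj K)"
    by (auto simp: isomorphic_to_subgraph_def digraph_iso_def)
qed

lemma isomorphic_to_subgraph_distance_graph_iff:
  assumes "nomulti_digraph G" and "d > 0"
  shows "isomorphic_to_subgraph G (with_proj (distance_graph S n d)) \<longleftrightarrow>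
    (\<exists>p. inj_on p (verts G) \<and> p ` verts G \<subseteq> {..<n} \<rightarrow>\<^sub>E S \<and>
      (\<forall>(u, v)\<in>arcs_ends G. (\<Sum>i<n. (p u i - p v i)\<^sup>2) = d\<^sup>2))"
proof -
  interpret nomulti_digraph G by fact
  interpret K: pair_bidirected_digraph "distance_graph S n d"
    by (rule distance_graph_bidirected) fact
  have L2: "L2_set (\<lambda>i. dist (x i) (y i)) {..<n} = d \<longleftrightarrow> (\<Sum>i<n. (x i - y i)\<^sup>2) = d\<^sup>2"
    for x y :: "nat \<Rightarrow> real"
  proof -
    have "L2_set (\<lambda>i. dist (x i) (y i)) {..<n} = sqrt (\<Sum>i<n. (x i - y i)\<^sup>2)"
      by (simp add: L2_set_def dist_real_def)
    then show ?thesis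
      using \<open>d > 0\<close> by (auto simp: sum_nonneg real_sqrt_unique)
  qed
  have ends: "u \<in> verts G" "v \<in> verts G" if "(u, v) \<in> arcs_ends G" for u v
    using that by (auto simp: arcs_ends_conv)
  have V: "pverts (distance_graph S n d) = {..<n} \<rightarrow>\<^sub>E S"
    by (simp add: distance_graph_def)
  have A: "(x, y) \<in> parcs (distance_graph S n d) \<longleftrightarrow>
      x \<in> {..<n} \<rightarrow>\<^sub>E S \<and> y \<in> {..<n} \<rightarrow>\<^sub>E S \<and> (\<Sum>i<n. (x i - y i)\<^sup>2) = d\<^sup>2" for x y
    by (simp add: distance_graph_def L2)
  have wf: "pair_wf_digraph (distance_graph S n d)" by unfold_locales
  show ?thesis
    unfolding isomorphic_to_subgraph_with_proj_iff[OF assms(1) wf] V A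
    by (rule ex_cong1) (use ends in fast)
qed

section \<open>Splitting the vertices, and the two embedding claims\<close>

text \<open>The parts other than \<open>W\<close> are singletons, so sharing a part means being
  equal or both lying in \<open>W\<close>.\<close>

lemma complete_multipartite_one_large_part:
  assumes "complete_multipartite_digraph (replicate_mset m 1 + {#k#}) G"
  obtains U W where "verts G = U \<union> W" and "U \<inter> W = {}" and "finite U"
    and "card U = m" and "card W = k"
    and "arcs_ends G = {(u, v). u \<in> verts G \<and> v \<in> verts G \<and> u \<noteq> v \<and> \<not> (u \<in> W \<and> v \<in> W)}"
proof -
  from assms obtain P where "graph G" and P: "partition_on (verts G) P"
    and M: "image_mset card (mset_set P) = add_mset k (replicate_mset m 1)"
    and A: "arcs_ends G = {(u, v). u \<in> verts G \<and> v \<in> verts G \<and> \<not> (\<exists>A\<in>P. u \<in> A \<and> v \<in> A)}"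
    by (auto simp: complete_multipartite_digraph_def)
  interpret graph G by fact
  have finP: "finite P" using finite_elements[OF finite_verts P] .
  \<comment> \<open>Inverting the multiset map picks one part of size \<open>k\<close> even if
    \<open>k = 1\<close>, where the size does not single it out.\<close>
  from msed_map_invR[OF M] obtain W N where WN: "mset_set P = add_mset W N" "card W = k"
    and N: "image_mset card N = replicate_mset m 1"
    by blast
  then have W: "W \<in># mset_set P" "card W = k"
    and M': "image_mset card (mset_set P - {#W#}) = replicate_mset m 1"
    by simp_all
  have WP: "W \<in> P" using W finP by simp
  let ?Q = "P - {W}"
  have M'': "image_mset card (mset_set ?Q) = replicate_mset m 1"
    using M' finP WP by (simp add: mset_set_Diff)
  have Q1: "card B = 1" if "B \<in> ?Q" for B
  proof -
    have "card B \<in># image_mset card (mset_set ?Q)" using that finP by simp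
    then show ?thesis unfolding M'' by (simp split: if_splits)
  qed
  have cQ: "card ?Q = m"
    using arg_cong[OF M'', of size] by simp
  have disj: "disjoint P" using P by (auto simp: partition_on_def)
  have un: "verts G = \<Union>P" using P by (auto simp: partition_on_def)
  have Qsing: "x = y" if "B \<in> ?Q" "x \<in> B" "y \<in> B" for B x y
    using Q1[OF that(1)] that by (auto simp: card_1_singleton_iff)
  have UW: "\<Union>?Q \<inter> W = {}"
    using disj WP by (auto simp: disjoint_def)
  have "card (\<Union>?Q) = (\<Sum>B\<in>?Q. card B)"
    using Q1 disj
    by (intro card_Union_disjoint) (auto simp: disjoint_def pairwise_def disjnt_def card_1_singleton_iff)
  also have "\<dots> = m" using Q1 cQ by simp
  finally have cU: "card (\<Union>?Q) = m" .
  have same: "(\<exists>B\<in>P. u \<in> B \<and> v \<in> B) \<longleftrightarrow> u = v \<or> u \<in> W \<and> v \<in> W"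
    if "u \<in> verts G" "v \<in> verts G" for u v
  proof
    assume "\<exists>B\<in>P. u \<in> B \<and> v \<in> B"
    then obtain B where "B \<in> P" "u \<in> B" "v \<in> B" by blast
    then show "u = v \<or> u \<in> W \<and> v \<in> W" using Qsing[of B u v] by auto
  next
    assume "u = v \<or> u \<in> W \<and> v \<in> W"
    then show "\<exists>B\<in>P. u \<in> B \<and> v \<in> B" using that(1) WP un by auto
  qed
  show ?thesis
  proof (rule that[of "\<Union>?Q" W])
    show "verts G = \<Union>?Q \<union> W" using un WP by auto
    then show "finite (\<Union>?Q)" using finite_verts by simp
    show "arcs_ends G = {(u, v). u \<in> verts G \<and> v \<in> verts G \<and> u \<noteq> v \<and> \<not> (u \<in> W \<and> v \<in> W)}"
      unfolding A using same by auto
  qed (fact UW cU W(2))+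
qed

theorem theorem3p5:
  fixes n :: nat and G :: "('a, 'b) pre_digraph"
  assumes "n \<ge> 2"
    and "complete_multipartite_digraph (replicate_mset (n - 1) 1 + {#3#}) G"
  shows "isomorphic_to_subgraph G (with_proj (distance_graph \<rat> n (sqrt 2))) \<and>
    \<not> isomorphic_to_subgraph G (with_proj (distance_graph UNIV (n - 1) 1))"
proof -
  define m where "m = n - 1"
  have n: "n = Suc m" and m: "m \<noteq> 0" using assms(1) by (auto simp: m_def)
  obtain U W where V: "verts G = U \<union> W" and UW: "U \<inter> W = {}" and fin: "finite U"
    and cU: "card U = m" and cW: "card W = 3"
    and A: "arcs_ends G = {(u, v). u \<in> verts G \<and> v \<in> verts G \<and> u \<noteq> v \<and> \<not> (u \<in> W \<and> v \<in> W)}"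
    by (rule complete_multipartite_one_large_part[OF assms(2), folded m_def])
  interpret graph G using assms(2) by (simp add: complete_multipartite_digraph_def)
  have nm: "nomulti_digraph G" by unfold_locales
  have "isomorphic_to_subgraph G (with_proj (distance_graph \<rat> n (sqrt 2)))"
  proof -
    obtain p :: "'a \<Rightarrow> nat \<Rightarrow> real" where p: "p ` (U \<union> W) \<subseteq> {..<Suc m} \<rightarrow>\<^sub>E \<rat>" "inj_on p W"
      and D: "\<And>u v. u \<in> U \<Longrightarrow> v \<in> U \<union> W \<Longrightarrow> u \<noteq> v \<Longrightarrow> (\<Sum>i<Suc m. (p u i - p v i)\<^sup>2) = 2"
      by (rule rational_placement[OF fin cU m cW UW]) blast
    \<comment> \<open>Every arc has an end in \<open>U\<close>; if only the second one is, symmetry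
      of the distance helps.\<close>
    have D': "(\<Sum>i<Suc m. (p u i - p v i)\<^sup>2) = 2" if "(u, v) \<in> arcs_ends G" for u v
    proof (cases "u \<in> U")
      case True
      then show ?thesis using that D[of u v] A V by auto
    next
      case False
      then have "v \<in> U" using that A V by auto
      then show ?thesis using that D[of v u] A V by (auto simp: power2_commute)
    qed
    have "inj_on p (verts G)"
    proof (rule inj_onI, rule ccontr)
      fix u v assume uv: "u \<in> verts G" "v \<in> verts G" "p u = p v" "u \<noteq> v"
      then have "\<not> (u \<in> W \<and> v \<in> W)" using p(2) by (auto dest: inj_onD)
      then have "(u, v) \<in> arcs_ends G" using uv A by auto
      from D'[OF this] uv(3) show False by simp
    qed
    with p(1) D' show ?thesis
      by (subst isomorphic_to_subgraph_distance_graph_iff[OF nm])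
        (auto simp: V n intro!: exI[of _ p])
  qed
  moreover have "\<not> isomorphic_to_subgraph G (with_proj (distance_graph UNIV m 1))"
  proof
    assume "isomorphic_to_subgraph G (with_proj (distance_graph UNIV m 1))"
    then obtain p :: "'a \<Rightarrow> nat \<Rightarrow> real" where inj: "inj_on p (verts G)"
      and ext: "p ` verts G \<subseteq> {..<m} \<rightarrow>\<^sub>E UNIV"
      and D: "\<forall>(u, v)\<in>arcs_ends G. (\<Sum>i<m. (p u i - p v i)\<^sup>2) = 1"
      by (subst (asm) isomorphic_to_subgraph_distance_graph_iff[OF nm]) auto
    show False
    proof (rule no_equidistant_placement[OF fin cU cW UW, of p 1])
      fix u v assume "u \<in> U" "v \<in> U \<union> W" "u \<noteq> v"
      then show "(\<Sum>i<m. (p u i - p v i)\<^sup>2) = 1"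
        using UW D unfolding A V by blast
    next
      fix v w assume vw: "v \<in> W" "w \<in> W" "v \<noteq> w"
      then have "p v \<noteq> p w" using inj V by (auto dest: inj_onD)
      \<comment> \<open>Distinct extensional functions differ at an index below \<open>m\<close>,
        which gives a positive summand.\<close>
      moreover have "p v \<in> {..<m} \<rightarrow>\<^sub>E UNIV" "p w \<in> {..<m} \<rightarrow>\<^sub>E UNIV" using ext vw V by auto
      ultimately obtain i where "i < m" "p v i \<noteq> p w i"
        by (metis PiE_ext lessThan_iff)
      then show "(\<Sum>i<m. (p v i - p w i)\<^sup>2) > 0"
        by (intro sum_pos2[of _ i]) auto
    qed simp
  qed
  ultimately show ?thesis by (simp add: m_def)
qed

end
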